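(* Assume that, for every grid index $(i,j)\in\mathcal I$, the polynomial $R_{i,j}(x,y)$ satisfies $$\frac1{\Delta x\Delta y}\int_{y_{j-\frac12}}^{y_{j+\frac12}}\int_{x_{i-\frac12}}^{x_{i+\frac12}}R_{i,j}(x,y)\,dx\,dy=\bar u_{i,j}.$$ Then, for periodic functions $\bar u(x,y)$ with period $(L,L)=(Nh,Nh)$, $N\in\mathbb N$, $$\sum_{1\le i,j\le N}Q_{i+\theta,j+\eta}=\sum_{1\le i,j\le N}\bar u_{i,j}$$ for any $\theta,\eta\in[0,1)$.
   Context: Uniform grid with $\Delta x=\Delta y=h>0$, grid points $(x_i,y_j)$ with $x_i=i\Delta x$, $y_j=j\Delta y$, $x_{i\pm\frac12}=x_i\pm\Delta x/2$, $y_{j\pm\frac12}=y_j\pm\Delta y/2$, and $\mathcal I$ the set of grid indices. For a smooth function $u:\mathbb R^2\to\mathbb R$, its sliding average is $\bar u(x,y)=\frac1{\Delta x\Delta y}\int_{y-\Delta y/2}^{y+\Delta y/2}\int_{x-\Delta x/2}^{x+\Delta x/2}u(x',y')\,dx'\,dy'$, and $\bar u_{i,j}=\bar u(x_i,y_j)$ are the given cell averages. From the cell averages one has a piecewise polynomial reconstruction $R(x,y)=\sum_{i,j}R_{i,j}(x,y)\chi_{i,j}(x,y)$ of $u$, where $\chi_{i,j}$ is the characteristic function of the cell $I_{i,j}=[x_{i-\frac12},x_{i+\frac12}]\times[y_{j-\frac12},y_{j+\frac12}]$ and $R_{i,j}$ is a polynomial of degree $k$. For $\theta,\eta\in[0,1)$,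 the approximation of $\bar u(x_i+\theta\Delta x,y_j+\eta\Delta y)$ is the sliding average of $R$: $$Q_{i+\theta,j+\eta}=\frac1{\Delta x\Delta y}\int_{y_{j-\frac12}+\eta\Delta y}^{y_{j+\frac12}+\eta\Delta y}\int_{x_{i-\frac12}+\theta\Delta x}^{x_{i+\frac12}+\theta\Delta x}R(x,y)\,dx\,dy,$$ that is, $\frac1{\Delta x\Delta y}$ times the sum of the integrals of $R_{i,j},R_{i+1,j},R_{i,j+1},R_{i+1,j+1}$ over the intersections of the shifted cell with $I_{i,j},I_{i+1,j},I_{i,j+1},I_{i+1,j+1}$ respectively.
   Formalization: Added assumption: if the cell averages are N-periodic in i and j, then the reconstruction is too, i.e. R_{i+N,j}(x+Nh,y)=R_{i,j}(x,y) and R_{i,j+N}(x,y+Nh)=R_{i,j}(x,y); without it the claim fails for arbitrary conservative polynomials. *)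

theory Defs
  imports "HOL-Analysis.Analysis"
begin

text \<open>
  In finite dimension, continuity of all directional derivatives is
  continuity of the Frechet derivative, so this is the usual class of
  \<open>k\<close> times continuously differentiable functions.
\<close>

primrec cont_diff :: "nat \<Rightarrow> ('a::euclidean_space \<Rightarrow> real) \<Rightarrow> bool" where
  "cont_diff 0 f \<longleftrightarrow> continuous_on UNIV f"
| "cont_diff (Suc k) f \<longleftrightarrow>
     (\<exists>f'. (\<forall>x. (f has_derivative f' x) (at x)) \<and> (\<forall>v. cont_diff k (\<lambda>x. f' x v)))"

definition smooth :: "('a::euclidean_space \<Rightarrow> real) \<Rightarrow> bool" where
  "smooth f \<longleftrightarrow> (\<forall>k. cont_diff k f)"

text \<open>Following common usage, ``degree \<open>k\<close>'' means total degree at most \<open>k\<close>.\<close>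

definition bivariate_polynomial :: "nat \<Rightarrow> (real \<times> real \<Rightarrow> real) \<Rightarrow> bool" where
  "bivariate_polynomial k f \<longleftrightarrow>
     (\<exists>c :: nat \<Rightarrow> nat \<Rightarrow> real. \<forall>x y. f (x, y) = (\<Sum>a\<le>k. \<Sum>b\<le>k - a. c a b * x ^ a * y ^ b))"

definition sliding_average :: "real \<Rightarrow> (real \<times> real \<Rightarrow> real) \<Rightarrow> real \<times> real \<Rightarrow> real" where
  "sliding_average h f = (\<lambda>(x, y).
     1 / (h * h) * integral {y - h/2 .. y + h/2}
       (\<lambda>y'. integral {x - h/2 .. x + h/2} (\<lambda>x'. f (x', y'))))"

definition grid_point :: "real \<Rightarrow> int \<Rightarrow> int \<Rightarrow> real \<times> real" where
  "grid_point h i j = (of_int i * h, of_int j * h)"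

definition cell :: "real \<Rightarrow> int \<Rightarrow> int \<Rightarrow> (real \<times> real) set" where
  "cell h i j = {of_int i * h - h/2 .. of_int i * h + h/2} \<times>
                {of_int j * h - h/2 .. of_int j * h + h/2}"

text \<open>
  The cells are closed, so on a cell boundary two or four summands overlap.
  At every point only finitely many summands are nonzero.
\<close>

definition piecewise :: "real \<Rightarrow> (int \<Rightarrow> int \<Rightarrow> real \<times> real \<Rightarrow> real) \<Rightarrow> real \<times> real \<Rightarrow> real" where
  "piecewise h R p = (\<Sum>\<^sub>\<infinity>(i, j)\<in>UNIV. R i j p * indicator (cell h i j) p)"

text \<open>The value \<open>Q\<close> at the index \<open>(i + \<theta>, j + \<eta>)\<close>.\<close>

definition shifted_average ::
  "real \<Rightarrow> (int \<Rightarrow> int \<Rightarrow> real \<times> real \<Rightarrow> real) \<Rightarrow> real \<Rightarrow> real \<Rightarrow> int \<Rightarrow> int \<Rightarrow> real" where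
  "shifted_average h R \<theta> \<eta> i j =
     sliding_average h (piecewise h R) (grid_point h i j + (\<theta> * h, \<eta> * h))"

definition doubly_periodic :: "real \<Rightarrow> (real \<times> real \<Rightarrow> real) \<Rightarrow> bool" where
  "doubly_periodic L f \<longleftrightarrow> (\<forall>x y. f (x + L, y) = f (x, y) \<and> f (x, y + L) = f (x, y))"

text \<open>
  The polynomials \<open>R\<close> are reconstructed from the cell averages \<open>v\<close>.  What is
  needed of this dependence is that \<open>N\<close>-periodic averages yield the same
  polynomial, up to translation, in cells that are \<open>N\<close> cells apart.  Being
  conservative does not imply this: polynomials with equal averages over their
  cells need not be translates of each other.
\<close>

definition inherits_period ::
  "real \<Rightarrow> nat \<Rightarrow> (int \<Rightarrow> int \<Rightarrow> real) \<Rightarrow> (int \<Rightarrow> int \<Rightarrow> real \<times> real \<Rightarrow> real) \<Rightarrow> bool" where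
  "inherits_period h N v R \<longleftrightarrow>
     (\<forall>i j. v (i + int N) j = v i j \<and> v i (j + int N) = v i j) \<longrightarrow>
     (\<forall>i j x y. R (i + int N) j (x + real N * h, y) = R i j (x, y) \<and>
                R i (j + int N) (x, y + real N * h) = R i j (x, y))"

end

theory Submission
  imports Defs
begin

text \<open>
  A cell shifted by \<open>\<theta> * h\<close> consists of the right part of cell \<open>i\<close> and the left part of
  cell \<open>i + 1\<close>.  Summed over one period, the left parts telescope by periodicity, so the shifted
  cells give the same total integral as the unshifted ones.  This one-dimensional fact is applied
  in \<open>x\<close> for almost every \<open>y\<close>, and then in \<open>y\<close> to the resulting \<open>x\<close>-integrals.
\<close>

text \<open>The common edge of cells \<open>i\<close> and \<open>i + 1\<close> splits the shifted
  cell. On either side \<open>g\<close> agrees with a continuous function except possibly at cell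
  edges, which form a null set. Agreement is asked only on open cells because
  \<open>piecewise\<close> adds up overlapping values on the edges. The second summand is anchored
  at the left edge of cell \<open>i + 1\<close>, so that it becomes the left part of the next cell
  when the sum telescopes.\<close>

lemma has_integral_shifted_cell:
  fixes f :: "int \<Rightarrow> real \<Rightarrow> real" and g :: "real \<Rightarrow> real"
  assumes "h > 0" and \<theta>: "\<theta> \<in> {0..<1}"
    and cont: "\<And>i. continuous_on UNIV (f i)"
    and eq: "\<And>i x. x \<in> {of_int i * h - h/2 <..< of_int i * h + h/2} \<Longrightarrow> g x = f i x"
  shows "(g has_integral
           (integral {of_int i * h - h/2 + \<theta> * h .. of_int i * h + h/2} (f i) +
            integral {of_int (i + 1) * h - h/2 .. of_int (i + 1) * h - h/2 + \<theta> * h} (f (i + 1))))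
         {of_int i * h + \<theta> * h - h/2 .. of_int i * h + \<theta> * h + h/2}"
proof -
  define a where "a = of_int i * h - h/2 + \<theta> * h"
  define c where "c = of_int i * h + h/2"
  define b where "b = of_int i * h + \<theta> * h + h/2"
  have \<theta>h: "0 \<le> \<theta> * h" "\<theta> * h < h"
    using \<theta> \<open>h > 0\<close> by auto
  \<comment> \<open>The interior of \<open>{p..q}\<close> lies in the open cell \<open>m\<close>, so
    \<open>g\<close> can differ from \<open>f m\<close> only at the two endpoints.\<close>
  have piece: "(g has_integral integral {p..q} (f m)) {p..q}"
    if "of_int m * h - h/2 \<le> p" "q \<le> of_int m * h + h/2" for m p q
  proof (rule has_integral_spike_interior[of _ _ p q, unfolded box_real])
    show "(f m has_integral integral {p..q} (f m)) {p..q}"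
      by (intro integrable_integral integrable_continuous_real continuous_on_subset[OF cont]) auto
    show "g x = f m x" if "x \<in> {p<..<q}" for x
      using that \<open>of_int m * h - h/2 \<le> p\<close> \<open>q \<le> of_int m * h + h/2\<close> by (intro eq) auto
  qed
  have "(g has_integral integral {a..c} (f i)) {a..c}"
    using \<theta>h by (intro piece) (simp_all add: a_def c_def)
  moreover have "(g has_integral integral {c..b} (f (i + 1))) {c..b}"
    using \<theta> \<theta>h by (intro piece) (auto simp: b_def c_def algebra_simps)
  ultimately have "(g has_integral (integral {a..c} (f i) + integral {c..b} (f (i + 1)))) {a..b}"
    using \<theta> \<theta>h \<open>h > 0\<close> by (intro has_integral_combine) (auto simp: a_def b_def c_def)
  moreover have "a = of_int i * h + \<theta> * h - h/2" "c = of_int (i + 1) * h - h/2"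
      "b = of_int (i + 1) * h - h/2 + \<theta> * h"
    by (auto simp: a_def b_def c_def algebra_simps)
  ultimately show ?thesis
    unfolding a_def[symmetric] b_def[symmetric] c_def[symmetric] by metis
qed

text \<open>Both sums contain every right part \<open>A i\<close>. They differ by the sum of
  \<open>B (i + 1) - B i\<close>, which collapses to \<open>B (int N + 1) - B 1\<close>, and this is
  zero by \<open>per\<close>.\<close>

lemma sum_integral_shifted_cells:
  fixes f :: "int \<Rightarrow> real \<Rightarrow> real" and g :: "real \<Rightarrow> real"
  assumes "h > 0" and \<theta>: "\<theta> \<in> {0..<1}"
    and cont: "\<And>i. continuous_on UNIV (f i)"
    and eq: "\<And>i x. x \<in> {of_int i * h - h/2 <..< of_int i * h + h/2} \<Longrightarrow> g x = f i x"
    and per: "\<And>i x. f (i + int N) (x + real N * h) = f i x"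
  shows "(\<Sum>i = 1..int N. integral {of_int i * h + \<theta> * h - h/2 .. of_int i * h + \<theta> * h + h/2} g) =
         (\<Sum>i = 1..int N. integral {of_int i * h - h/2 .. of_int i * h + h/2} (f i))"
proof -
  define A where "A i = integral {of_int i * h - h/2 + \<theta> * h .. of_int i * h + h/2} (f i)" for i
  define B where "B i = integral {of_int i * h - h/2 .. of_int i * h - h/2 + \<theta> * h} (f i)" for i
  have \<theta>h: "0 \<le> \<theta> * h" "\<theta> * h < h"
    using \<theta> \<open>h > 0\<close> by auto
  have split_shifted: "integral {of_int i * h + \<theta> * h - h/2 .. of_int i * h + \<theta> * h + h/2} g = A i + B (i + 1)" for i
    unfolding A_def B_def using assms(1-4) by (intro integral_unique has_integral_shifted_cell)
  have split_cell: "integral {of_int i * h - h/2 .. of_int i * h + h/2} (f i) = B i + A i" for i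
    unfolding A_def B_def using \<theta> \<theta>h \<open>h > 0\<close>
    by (intro Henstock_Kurzweil_Integration.integral_combine[symmetric]
          integrable_continuous_real continuous_on_subset[OF cont]) auto
  have "B (i + int N) = B i" for i
  proof -
    \<comment> \<open>Translation by \<open>real N * h\<close> carries the left part of cell
      \<open>i\<close> onto that of cell \<open>i + int N\<close>.\<close>
    have "B i = integral {of_int i * h - h/2 .. of_int i * h - h/2 + \<theta> * h}
                 (\<lambda>x. f (i + int N) (x + real N * h))"
      unfolding B_def using per by simp
    also have "\<dots> = B (i + int N)"
      using integral_shift_real_ivl[of "of_int (i + int N) * h - h/2" "real N * h"
          "of_int (i + int N) * h - h/2 + \<theta> * h" "f (i + int N)"]
      by (simp add: B_def algebra_simps)
    finally show ?thesis ..
  qed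
  then have "B (int N + 1) = B 1"
    by (metis add.commute)
  moreover have "(\<Sum>i = 1..int N. B (i + 1) - B i) = B (int N + 1) - B 1"
    by (induction N) (auto simp: atLeastAtMostPlus1_int_conv add.commute)
  ultimately show ?thesis
    unfolding split_shifted split_cell by (simp add: sum.distrib sum_subtractf)
qed

lemma continuous_on_bivariate_polynomial:
  assumes "bivariate_polynomial k f"
  shows "continuous_on S f"
proof -
  obtain c where "\<And>x y. f (x, y) = (\<Sum>a\<le>k. \<Sum>b\<le>k - a. c a b * x ^ a * y ^ b)"
    using assms unfolding bivariate_polynomial_def by blast
  then have "f = (\<lambda>p. \<Sum>a\<le>k. \<Sum>b\<le>k - a. c a b * fst p ^ a * snd p ^ b)"
    by auto
  then show ?thesis
    by (auto intro!: continuous_intros)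
qed

text \<open>This makes the inner integrals admissible as the continuous pieces when the
  one-dimensional lemmas are applied in \<open>y\<close>.\<close>

lemma continuous_on_integral_fst:
  fixes f :: "real \<times> real \<Rightarrow> real"
  assumes "continuous_on UNIV f"
  shows "continuous_on S (\<lambda>y. integral {a..b} (\<lambda>x. f (x, y)))"
proof -
  have "continuous_on (S \<times> cbox a b) (\<lambda>(y, x). f (x, y))"
    unfolding case_prod_unfold
    by (intro continuous_on_compose2[OF assms] continuous_intros) auto
  from integral_continuous_on_param[OF this] show ?thesis
    by simp
qed

text \<open>The point is less than \<open>h/2\<close> from one centre and at most \<open>h/2\<close>
  from the other, so the centres are less than \<open>h\<close> apart and the integers
  \<open>l\<close> and \<open>i\<close> coincide.\<close>

lemma open_cell_unique:
  fixes h x :: real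
  assumes "h > 0" and x: "x \<in> {of_int i * h - h/2 <..< of_int i * h + h/2}"
    and l: "x \<in> {of_int l * h - h/2 .. of_int l * h + h/2}"
  shows "l = i"
proof -
  have "of_int (l - i) * h < 1 * h" "of_int (i - l) * h < 1 * h"
    using x l by (auto simp: algebra_simps)
  then have "of_int (l - i) < (1::real)" "of_int (i - l) < (1::real)"
    using \<open>h > 0\<close> by (simp_all only: mult_less_cancel_right_pos)
  then show ?thesis
    by linarith
qed

lemma piecewise_open_cell:
  assumes "h > 0"
    and x: "x \<in> {of_int i * h - h/2 <..< of_int i * h + h/2}"
    and y: "y \<in> {of_int j * h - h/2 <..< of_int j * h + h/2}"
  shows "piecewise h R (x, y) = R i j (x, y)"
proof -
  have "(x, y) \<in> cell h l m \<longleftrightarrow> l = i \<and> m = j" for l m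
    using open_cell_unique[OF \<open>h > 0\<close> x, of l] open_cell_unique[OF \<open>h > 0\<close> y, of m] x y
    by (auto simp: cell_def)
  \<comment> \<open>Only the index \<open>(i, j)\<close> contributes, so the infinite sum reduces to
    a single term.\<close>
  then have "piecewise h R (x, y) =
      (\<Sum>\<^sub>\<infinity>p\<in>{(i, j)}. case p of (l, m) \<Rightarrow> R l m (x, y) * indicator (cell h l m) (x, y))"
    unfolding piecewise_def by (intro infsum_cong_neutral) (auto simp: indicator_def)
  also have "\<dots> = R i j (x, y)"
    using \<open>\<And>l m. (x, y) \<in> cell h l m \<longleftrightarrow> l = i \<and> m = j\<close> by simp
  finally show ?thesis .
qed

lemma sum_integral_piecewise_shifted:
  fixes R :: "int \<Rightarrow> int \<Rightarrow> real \<times> real \<Rightarrow> real"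
  assumes "h > 0" and \<theta>: "\<theta> \<in> {0..<1}" and \<eta>: "\<eta> \<in> {0..<1}"
    and cont: "\<And>i j. continuous_on UNIV (R i j)"
    and per_x: "\<And>i j x y. R (i + int N) j (x + real N * h, y) = R i j (x, y)"
    and per_y: "\<And>i j x y. R i (j + int N) (x, y + real N * h) = R i j (x, y)"
  shows "(\<Sum>i = 1..int N. \<Sum>j = 1..int N.
            integral {of_int j * h + \<eta> * h - h/2 .. of_int j * h + \<eta> * h + h/2} (\<lambda>y.
              integral {of_int i * h + \<theta> * h - h/2 .. of_int i * h + \<theta> * h + h/2} (\<lambda>x.
                piecewise h R (x, y)))) =
         (\<Sum>i = 1..int N. \<Sum>j = 1..int N.
            integral {of_int j * h - h/2 .. of_int j * h + h/2} (\<lambda>y.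
              integral {of_int i * h - h/2 .. of_int i * h + h/2} (\<lambda>x. R i j (x, y))))"
proof -
  define I where "I i = {of_int i * h - h/2 .. of_int i * h + h/2}" for i :: int
  define Ix where "Ix i = {of_int i * h + \<theta> * h - h/2 .. of_int i * h + \<theta> * h + h/2}" for i :: int
  define Jy where "Jy j = {of_int j * h + \<eta> * h - h/2 .. of_int j * h + \<eta> * h + h/2}" for j :: int
  define g where "g i y = integral (Ix i) (\<lambda>x. piecewise h R (x, y))" for i y
  define F where "F j y = (\<Sum>i = 1..int N. integral (I i) (\<lambda>x. R i j (x, y)))" for j y
  have cont_x: "continuous_on UNIV (\<lambda>x. R i j (x, y))" for i j y
    by (intro continuous_on_compose2[OF cont] continuous_intros) auto
  \<comment> \<open>For a single \<open>i\<close>, this shows that \<open>g i\<close> agrees on each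
    open strip with a function continuous in \<open>y\<close>. That yields the integrability needed
    to exchange sum and integral.\<close>
  have g_eq: "g i y = integral {of_int i * h - h/2 + \<theta> * h .. of_int i * h + h/2} (\<lambda>x. R i j (x, y)) +
      integral {of_int (i + 1) * h - h/2 .. of_int (i + 1) * h - h/2 + \<theta> * h} (\<lambda>x. R (i + 1) j (x, y))"
    if "y \<in> {of_int j * h - h/2 <..< of_int j * h + h/2}" for i j y
    unfolding g_def Ix_def
    by (intro integral_unique has_integral_shifted_cell[where f = "\<lambda>i x. R i j (x, y)"]
          piecewise_open_cell cont_x that \<open>h > 0\<close> \<theta>)
  have g_integrable: "g i integrable_on Jy j" for i j
    unfolding Jy_def
    by (rule has_integral_integrable, rule has_integral_shifted_cell[OF \<open>h > 0\<close> \<eta> _ g_eq])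
      (rule continuous_on_add continuous_on_integral_fst cont)+
  have cont_F: "continuous_on UNIV (F j)" for j
    unfolding F_def I_def by (intro continuous_intros continuous_on_integral_fst cont)
  \<comment> \<open>First use of the telescoping, in \<open>x\<close> at a fixed \<open>y\<close>
    inside an open strip. On that strip the sum of the \<open>g i\<close> is the continuous piece
    \<open>F j\<close>.\<close>
  have sum_g: "(\<Sum>i = 1..int N. g i y) = F j y"
    if "y \<in> {of_int j * h - h/2 <..< of_int j * h + h/2}" for j y
    unfolding g_def F_def Ix_def I_def
    by (intro sum_integral_shifted_cells[where f = "\<lambda>i x. R i j (x, y)"]
          piecewise_open_cell cont_x that \<open>h > 0\<close> \<theta> per_x)
  have per_F: "F (j + int N) (y + real N * h) = F j y" for j y
    unfolding F_def per_y ..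
  \<comment> \<open>The sum over \<open>i\<close> moves inside the integral because
    \<open>sum_g\<close> identifies only the whole sum with \<open>F j\<close>. The telescoping can
    then be used again, in \<open>y\<close>.\<close>
  have "(\<Sum>i = 1..int N. \<Sum>j = 1..int N. integral (Jy j) (g i)) =
      (\<Sum>j = 1..int N. integral (Jy j) (\<lambda>y. \<Sum>i = 1..int N. g i y))"
    by (subst sum.swap) (simp add: integral_sum g_integrable)
  also have "\<dots> = (\<Sum>j = 1..int N. integral (I j) (F j))"
    unfolding Jy_def I_def
    by (intro sum_integral_shifted_cells[OF \<open>h > 0\<close> \<eta> cont_F] sum_g per_F)
  also have "\<dots> = (\<Sum>j = 1..int N. \<Sum>i = 1..int N. integral (I j) (\<lambda>y. integral (I i) (\<lambda>x. R i j (x, y))))"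
    unfolding F_def I_def
    by (intro sum.cong refl integral_sum integrable_continuous_real continuous_on_integral_fst cont) auto
  also have "\<dots> = (\<Sum>i = 1..int N. \<Sum>j = 1..int N. integral (I j) (\<lambda>y. integral (I i) (\<lambda>x. R i j (x, y))))"
    by (rule sum.swap)
  finally show ?thesis
    unfolding g_def I_def Ix_def Jy_def .
qed

theorem proposition3p2:
  fixes h \<theta> \<eta> :: real
    and k N :: nat
    and u ubar :: "real \<times> real \<Rightarrow> real"
    and R :: "int \<Rightarrow> int \<Rightarrow> real \<times> real \<Rightarrow> real"
  assumes "h > 0"
    and "smooth u"
    and "ubar = sliding_average h u"
    and "\<And>i j. bivariate_polynomial k (R i j)"
    and "inherits_period h N (\<lambda>i j. ubar (grid_point h i j)) R"
    and "\<And>i j. sliding_average h (R i j) (grid_point h i j) = ubar (grid_point h i j)"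
    and "doubly_periodic (real N * h) ubar"
    and "\<theta> \<in> {0..<1}" and "\<eta> \<in> {0..<1}"
  shows "(\<Sum>i = 1..int N. \<Sum>j = 1..int N. shifted_average h R \<theta> \<eta> i j) =
         (\<Sum>i = 1..int N. \<Sum>j = 1..int N. ubar (grid_point h i j))"
proof -
  \<comment> \<open>Moving an index by \<open>N\<close> moves the grid point by the period
    \<open>real N * h\<close>, which gives the premise inside
    \<open>inherits_period\<close>.\<close>
  have "\<forall>i j. ubar (grid_point h (i + int N) j) = ubar (grid_point h i j) \<and>
              ubar (grid_point h i (j + int N)) = ubar (grid_point h i j)"
    using \<open>doubly_periodic (real N * h) ubar\<close>
    by (simp add: doubly_periodic_def grid_point_def distrib_right)
  then have per: "R (i + int N) j (x + real N * h, y) = R i j (x, y)"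
      "R i (j + int N) (x, y + real N * h) = R i j (x, y)" for i j x y
    using \<open>inherits_period h N _ R\<close> unfolding inherits_period_def by blast+
  have cont: "continuous_on UNIV (R i j)" for i j
    using assms(4) by (rule continuous_on_bivariate_polynomial)
  show ?thesis
    \<comment> \<open>Conservation, read backwards, turns each cell average into an integral of
      \<open>R i j\<close>. Both sides then share the factor \<open>1 / (h * h)\<close>.\<close>
    unfolding assms(6)[symmetric] shifted_average_def
    using sum_integral_piecewise_shifted[of h \<theta> \<eta> R N] \<open>h > 0\<close> \<open>\<theta> \<in> {0..<1}\<close> \<open>\<eta> \<in> {0..<1}\<close> cont per
    by (simp add: sliding_average_def grid_point_def sum_divide_distrib[symmetric])
qed

end
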